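(* Let $f:\mathbb{R}^n\to\mathbb{R}$ be continuously differentiable, bounded below with infimum $f_{\rm low}$, and $(\alpha,L_0,L_1)$-smooth for some $\alpha\in[0,1]$ and $L_0,L_1\ge 0$ (not both zero). Let the trust-region algorithm described in the context be applied to $f$, and assume there are $b_0,b_1\ge 0$ with $L_0\ge b_0$, $L_1\ge b_1$ such that $\|B_k\|\le b_0+b_1\|\nabla f(x_k)\|^\alpha$ for all $k\in\mathbb{N}$. Assume moreover that $f$ is convex and that there exists $R>0$ such that $\|x-x^*\|\le R$ for every $x$ satisfying $f(x)\le f(x_0)$, where $x^*$ is a minimizer of $f$. Assume that the algorithm generates infinitely many successful iterations. Let $\delta_k=f(x_k)-f_{\rm low}$, let $0<\epsilon<1$, let $\widehat{k}_\epsilon$ be the first iteration such that $\delta_{\widehat{k}_\epsilon}>\epsilon$ and $\delta_{\widehat{k}_\epsilon+1}\le\epsilon$, and let $\widehat{\mathcal{S}}(\epsilon)$ be the set of successful iterations $k$ with $k<\widehat{k}_\epsilon$. Define $$\widehat\kappa_0=\frac{R^2}{\eta_1\kappa_{\rm mdc}^2(1-\eta_2)\theta_{\min}},\qquad \widehat\kappa_\alpha=\frac{L_1\bigl(1+(\kappa_{\rm mdc}(1-\eta_2))^\alpha\bigr)}{R^\alpha(1-\alpha)}\widehat\kappa_0\ \ (\alpha<1),$$ $$\widehat\kappa_1=\frac{L_1\bigl(1+\kappa_{\rm mdc}(1-\eta_2)\bigr)}{R}\widehat\kappa_0,\qquad \widehat\kappa_2=L_0\widehat\kappa_0.$$ Then,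 if $\alpha\in[0,1)$, $$|\widehat{\mathcal{S}}(\epsilon)|\le\widehat\kappa_\alpha\,\epsilon^{\alpha-1}+\widehat\kappa_2\,\epsilon^{-1}-\widehat\kappa_\alpha\,\delta_0^{\alpha-1},$$ and if $\alpha=1$, $$|\widehat{\mathcal{S}}(\epsilon)|\le\widehat\kappa_1\log(\delta_0/\epsilon)+\widehat\kappa_2\,\epsilon^{-1}.$$
   Context: Convention: $0^0=1$; $\|\cdot\|$ is the Euclidean norm and its induced matrix norm. Smoothness. A continuously differentiable $f$ is $(\alpha,L_0,L_1)$-smooth (with $L_0>0$ or $L_1>0$) if for all $x,y\in\mathbb{R}^n$, $\|\nabla f(x)-\nabla f(y)\|\le\bigl(L_0+L_1\int_0^1\|\nabla f(x+t(y-x))\|^\alpha dt\bigr)\|x-y\|$. Trust-region algorithm. Constants: $\kappa_{\rm mdc}\in(0,\frac12]$, $0<\eta_1\le\eta_2<1$, $0<\gamma_1\le\gamma_2<1\le\gamma_3$, $x_0\in\mathbb{R}^n$, $\Delta_0>0$. For $k=0,1,\dots$: choose a symmetric $B_k\in\mathbb{R}^{n\times n}$ and let $m_k(s)=f(x_k)+\nabla f(x_k)^Ts+\frac12s^TB_ks$; compute any $s_k$ with $\|s_k\|\le\Delta_k$ and $m_k(0)-m_k(s_k)\ge\kappa_{\rm mdc}\|\nabla f(x_k)\|\min\{\|\nabla f(x_k)\|/\|B_k\|,\Delta_k\}$ (with $\|\nabla f(x_k)\|/\|B_k\|=+\infty$ if $B_k=0$); set $\rho_k=\frac{f(x_k)-f(x_k+s_k)}{m_k(0)-m_k(s_k)}$;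 set $x_{k+1}=x_k+s_k$ if $\rho_k\ge\eta_1$ (successful iteration), and $x_{k+1}=x_k$ otherwise; choose $\Delta_{k+1}\in[\Delta_k,\gamma_3\Delta_k]$ if $\rho_k\ge\eta_2$, $\Delta_{k+1}\in[\gamma_2\Delta_k,\Delta_k]$ if $\eta_1\le\rho_k<\eta_2$, and $\Delta_{k+1}\in[\gamma_1\Delta_k,\gamma_2\Delta_k]$ if $\rho_k<\eta_1$. Auxiliary functions. For $a\ge0,b>0$: $g(a,b)=\Bigl(1+\frac{(1-\alpha)L_1a^\alpha}{(L_0+L_1b^\alpha)^{1-\alpha}}\Bigr)^{1/(1-\alpha)}$ if $\alpha\in[0,1)$, and $g(a,b)=\exp(L_1a)$ if $\alpha=1$. For $b,t>0$, $h(b,t)$ is the unique $a>0$ with $a\,g(a,b)=t$. For $t>0$, $\psi(t)=\frac{t}{L_0+L_1t^\alpha}$. Finally $$\theta_{\min}=\gamma_1\min\Bigl\{1,\frac{\Delta_0}{h(\|\nabla f(x_0)\|,\kappa_{\rm mdc}(1-\eta_2)\psi(\|\nabla f(x_0)\|))}\Bigr\}.$$ *)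

theory Defs
  imports "HOL-Analysis.Analysis"
begin

(* Real powers of nonnegative numbers with 0^0 = 1; note that 0 powr 0 = 0.
   powr is used directly wherever the base is positive or the exponent is nonzero. *)
definition rpow :: "real \<Rightarrow> real \<Rightarrow> real" where
  "rpow t a = (if a = 0 then 1 else t powr a)"

definition grad :: "('a::real_inner \<Rightarrow> real) \<Rightarrow> 'a \<Rightarrow> 'a" where
  "grad f x = (THE D. GDERIV f x :> D)"

definition continuously_differentiable :: "('a::real_inner \<Rightarrow> real) \<Rightarrow> bool" where
  "continuously_differentiable f \<longleftrightarrow>
     (\<forall>x. f differentiable (at x)) \<and> continuous_on UNIV (grad f)"

definition gen_smooth :: "real \<Rightarrow> real \<Rightarrow> real \<Rightarrow> ('a::real_inner \<Rightarrow> real) \<Rightarrow> bool" where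
  "gen_smooth \<alpha> L\<^sub>0 L\<^sub>1 f \<longleftrightarrow> (L\<^sub>0 > 0 \<or> L\<^sub>1 > 0) \<and>
     (\<forall>x y. norm (grad f x - grad f y) \<le>
        (L\<^sub>0 + L\<^sub>1 * integral {0..1} (\<lambda>t. rpow (norm (grad f (x + t *\<^sub>R (y - x)))) \<alpha>)) * norm (x - y))"

(* The matrix norm induced by the Euclidean norm; norm on real^'n^'n is the Frobenius norm. *)
definition matrix_norm :: "real^'n^'m \<Rightarrow> real" where
  "matrix_norm B = onorm (\<lambda>v. B *v v)"

definition tr_model :: "(real^'n \<Rightarrow> real) \<Rightarrow> real^'n \<Rightarrow> real^'n^'n \<Rightarrow> real^'n \<Rightarrow> real" where
  "tr_model f x B s = f x + grad f x \<bullet> s + (1/2) * (s \<bullet> (B *v s))"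

(* min {||grad f x|| / ||B||, D}, where the quotient is infinite if B = 0. *)
definition cauchy_length :: "(real^'n \<Rightarrow> real) \<Rightarrow> real^'n \<Rightarrow> real^'n^'n \<Rightarrow> real \<Rightarrow> real" where
  "cauchy_length f x B D =
     (if B = 0 then D else min (norm (grad f x) / matrix_norm B) D)"

(* If the predicted decrease vanishes (possible only where grad f x = 0), the ratio is 0
   by division by zero, so such an iteration counts as unsuccessful. *)
definition tr_ratio :: "(real^'n \<Rightarrow> real) \<Rightarrow> real^'n \<Rightarrow> real^'n^'n \<Rightarrow> real^'n \<Rightarrow> real" where
  "tr_ratio f x B s = (f x - f (x + s)) / (tr_model f x B 0 - tr_model f x B s)"

(* x, \<Delta>, B, s are the sequences of iterates, radii, model Hessians and steps of some run
   of the algorithm started from x 0 with radius \<Delta> 0. *)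
definition trust_region_run ::
  "(real^'n \<Rightarrow> real) \<Rightarrow> real \<Rightarrow> real \<Rightarrow> real \<Rightarrow> real \<Rightarrow> real \<Rightarrow> real \<Rightarrow>
   (nat \<Rightarrow> real^'n) \<Rightarrow> (nat \<Rightarrow> real) \<Rightarrow> (nat \<Rightarrow> real^'n^'n) \<Rightarrow> (nat \<Rightarrow> real^'n) \<Rightarrow> bool" where
  "trust_region_run f \<kappa>\<^sub>m \<eta>\<^sub>1 \<eta>\<^sub>2 \<gamma>\<^sub>1 \<gamma>\<^sub>2 \<gamma>\<^sub>3 x \<Delta> B s \<longleftrightarrow>
     0 < \<Delta> 0 \<and>
     (\<forall>k. transpose (B k) = B k \<and>
          norm (s k) \<le> \<Delta> k \<and>
          tr_model f (x k) (B k) 0 - tr_model f (x k) (B k) (s k)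
            \<ge> \<kappa>\<^sub>m * norm (grad f (x k)) * cauchy_length f (x k) (B k) (\<Delta> k) \<and>
          (let \<rho> = tr_ratio f (x k) (B k) (s k) in
            x (Suc k) = (if \<rho> \<ge> \<eta>\<^sub>1 then x k + s k else x k) \<and>
            (\<rho> \<ge> \<eta>\<^sub>2 \<longrightarrow> \<Delta> (Suc k) \<in> {\<Delta> k .. \<gamma>\<^sub>3 * \<Delta> k}) \<and>
            (\<eta>\<^sub>1 \<le> \<rho> \<and> \<rho> < \<eta>\<^sub>2 \<longrightarrow> \<Delta> (Suc k) \<in> {\<gamma>\<^sub>2 * \<Delta> k .. \<Delta> k}) \<and>
            (\<rho> < \<eta>\<^sub>1 \<longrightarrow> \<Delta> (Suc k) \<in> {\<gamma>\<^sub>1 * \<Delta> k .. \<gamma>\<^sub>2 * \<Delta> k})))"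

definition successful_iterations ::
  "(real^'n \<Rightarrow> real) \<Rightarrow> real \<Rightarrow> (nat \<Rightarrow> real^'n) \<Rightarrow> (nat \<Rightarrow> real^'n^'n) \<Rightarrow> (nat \<Rightarrow> real^'n) \<Rightarrow> nat set" where
  "successful_iterations f \<eta>\<^sub>1 x B s = {k. tr_ratio f (x k) (B k) (s k) \<ge> \<eta>\<^sub>1}"

definition first_crossing :: "(nat \<Rightarrow> real) \<Rightarrow> real \<Rightarrow> nat \<Rightarrow> bool" where
  "first_crossing \<delta> \<epsilon> k \<longleftrightarrow> (\<delta> k > \<epsilon> \<and> \<delta> (Suc k) \<le> \<epsilon>) \<and>
     (\<forall>j<k. \<not> (\<delta> j > \<epsilon> \<and> \<delta> (Suc j) \<le> \<epsilon>))"

definition g_aux :: "real \<Rightarrow> real \<Rightarrow> real \<Rightarrow> real \<Rightarrow> real \<Rightarrow> real" where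
  "g_aux \<alpha> L\<^sub>0 L\<^sub>1 a b =
     (if \<alpha> = 1 then exp (L\<^sub>1 * a)
      else (1 + (1 - \<alpha>) * L\<^sub>1 * rpow a \<alpha> / (L\<^sub>0 + L\<^sub>1 * rpow b \<alpha>) powr (1 - \<alpha>)) powr (1 / (1 - \<alpha>)))"

definition h_aux :: "real \<Rightarrow> real \<Rightarrow> real \<Rightarrow> real \<Rightarrow> real \<Rightarrow> real" where
  "h_aux \<alpha> L\<^sub>0 L\<^sub>1 b t = (THE a. a > 0 \<and> a * g_aux \<alpha> L\<^sub>0 L\<^sub>1 a b = t)"

definition psi_aux :: "real \<Rightarrow> real \<Rightarrow> real \<Rightarrow> real \<Rightarrow> real" where
  "psi_aux \<alpha> L\<^sub>0 L\<^sub>1 t = t / (L\<^sub>0 + L\<^sub>1 * rpow t \<alpha>)"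

(* b stands for norm (grad f (x 0)), D for the initial radius. *)
definition theta_min ::
  "real \<Rightarrow> real \<Rightarrow> real \<Rightarrow> real \<Rightarrow> real \<Rightarrow> real \<Rightarrow> real \<Rightarrow> real \<Rightarrow> real" where
  "theta_min \<alpha> L\<^sub>0 L\<^sub>1 \<kappa>\<^sub>m \<eta>\<^sub>2 \<gamma>\<^sub>1 b D =
     \<gamma>\<^sub>1 * min 1 (D / h_aux \<alpha> L\<^sub>0 L\<^sub>1 b (\<kappa>\<^sub>m * (1 - \<eta>\<^sub>2) * psi_aux \<alpha> L\<^sub>0 L\<^sub>1 b))"

end

theory Submission
  imports Defs
begin

text \<open>
  A Gronwall-type argument turns generalized smoothness into
  \<open>norm (grad f (x + v) - grad f x) \<le> D * norm v * g (norm v)\<close> with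
  \<open>D = L\<^sub>0 + L\<^sub>1 * norm (grad f x) powr \<alpha>\<close>, hence into a descent inequality showing that an
  iteration is very successful as soon as its radius is at most
  \<open>h\<^sub>k = h (G\<^sub>k, c * \<psi> G\<^sub>k)\<close>, where \<open>G\<^sub>k = norm (grad f (x\<^sub>k))\<close> and \<open>c = \<kappa>\<^sub>m * (1 - \<eta>\<^sub>2)\<close>.
  So \<open>\<Delta>\<^sub>k \<ge> \<theta> * q\<close> for every common lower bound \<open>q\<close> of \<open>h\<^sub>0, \<dots>, h\<^sub>k\<close>. Convexity gives
  \<open>G\<^sub>j \<ge> \<delta>\<^sub>j / R \<ge> \<delta>\<^sub>k / R\<close> for \<open>j \<le> k\<close>, and \<open>h\<close> is bounded below by an increasing function of
  the gradient norm, so each successful iteration decreases the gap \<open>\<delta>\<^sub>k\<close> by at least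
  \<open>1 / w \<delta>\<^sub>k\<close> for a decreasing function \<open>w\<close>. The number of successful iterations is therefore at
  most the integral of \<open>w\<close> from \<open>\<epsilon>\<close> to \<open>\<delta>\<^sub>0\<close>.
\<close>

section \<open>Real powers under the convention that zero to the power zero is one\<close>

lemma rpow_nonneg [simp]: "0 \<le> rpow t a"
  by (simp add: rpow_def)

lemma rpow_pos: "0 < t \<Longrightarrow> 0 < rpow t a"
  by (simp add: rpow_def)

lemma linear_rpow_pos:
  fixes P Q :: real
  assumes "0 \<le> P" "0 \<le> Q" "0 < P \<or> 0 < Q" "0 < t"
  shows "0 < P + Q * rpow t a"
  using assms rpow_pos[of t a] by (auto intro: add_pos_nonneg add_nonneg_pos)

lemma rpow_eq_powr: "0 < t \<Longrightarrow> rpow t a = t powr a"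
  by (simp add: rpow_def)

lemma rpow_mono: "0 \<le> s \<Longrightarrow> s \<le> t \<Longrightarrow> 0 \<le> a \<Longrightarrow> rpow s a \<le> rpow t a"
  by (simp add: rpow_def powr_mono2)

text \<open>After division by \<open>u = s + t\<close> both arguments lie in [0, 1] and sum to 1; on
  [0, 1] an exponent between 0 and 1 does not decrease a number.\<close>

lemma rpow_add_le:
  assumes "0 \<le> s" "0 \<le> t" "0 \<le> a" "a \<le> 1"
  shows "rpow (s + t) a \<le> rpow s a + rpow t a"
proof (cases "a = 0 \<or> s + t = 0")
  case True
  then show ?thesis using assms by (auto simp: rpow_def)
next
  case False
  define u where "u = s + t"
  have u: "u > 0" "s \<le> u" "t \<le> u" using False assms by (auto simp: u_def)
  have *: "y / u \<le> (y / u) powr a" if "0 \<le> y" "y \<le> u" for y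
  proof -
    have "(y / u) powr 1 \<le> (y / u) powr a"
      using that u assms by (intro powr_mono') auto
    then show ?thesis using that u by simp
  qed
  have "1 = s / u + t / u" using u False assms by (simp add: u_def add_divide_distrib[symmetric])
  also have "\<dots> \<le> (s / u) powr a + (t / u) powr a"
    using * u assms by (intro add_mono) auto
  also have "\<dots> = (s powr a + t powr a) / u powr a"
    using u assms by (simp add: powr_divide add_divide_distrib)
  finally have "u powr a \<le> s powr a + t powr a"
    using u by (simp add: field_simps)
  then show ?thesis using False by (simp add: rpow_def u_def)
qed

lemma continuous_on_rpow:
  assumes "continuous_on S f" "\<And>x. x \<in> S \<Longrightarrow> 0 \<le> f x" "0 \<le> a"
  shows "continuous_on S (\<lambda>x. rpow (f x) a)"
  using assms by (cases "a = 0") (auto simp: rpow_def intro!: continuous_on_powr')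

section \<open>A Gronwall-type integral inequality\<close>

text \<open>
  Let \<open>Z\<close> be the integral on the right-hand side. Since \<open>Z t \<ge> A * t\<close>, the derivative
  \<open>(1 - a) * Z t powr (- a) * Z' t\<close> of \<open>Z powr (1 - a)\<close> is at most
  \<open>(1 - a) * ((A * t) powr (- a) * A + C)\<close>, which integrates explicitly. Bounding the integral by
  monotonicity of \<open>Z\<close> alone would lose the factor \<open>1 - a\<close>.
\<close>

lemma rpow_gronwall:
  fixes \<phi> :: "real \<Rightarrow> real"
  assumes cont: "continuous_on {0..1} \<phi>" and nonneg: "\<And>t. 0 \<le> \<phi> t"
    and A: "0 < A" and C: "0 \<le> C" and a: "0 \<le> a" "a \<le> 1"
    and le: "\<And>t. 0 \<le> t \<Longrightarrow> t \<le> 1 \<Longrightarrow> \<phi> t \<le> integral {0..t} (\<lambda>\<tau>. A + C * rpow (\<phi> \<tau>) a)"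
  shows "\<phi> 1 \<le> (if a = 1 then A * exp C
                  else (A powr (1 - a) + (1 - a) * C) powr (1 / (1 - a)))"
proof -
  define v where "v = (\<lambda>\<tau>. A + C * rpow (\<phi> \<tau>) a)"
  define Z where "Z = (\<lambda>t. integral {0..t} v)"
  have cv: "continuous_on {0..1} v"
    unfolding v_def using cont nonneg a by (intro continuous_intros continuous_on_rpow) auto
  have iv: "v integrable_on {0..t}" if "t \<le> 1" for t
    using that continuous_on_subset[OF cv] by (intro integrable_continuous_real) auto
  have dZ: "(Z has_real_derivative v t) (at t)" if "0 < t" "t < 1" for t
    using integral_has_real_derivative[OF cv, of t] that
    by (simp add: Z_def at_within_Icc_at)
  have cZ: "continuous_on {0..1} Z"
    unfolding Z_def by (intro indefinite_integral_continuous_1 iv) auto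
  have Z0: "Z 0 = 0" by (simp add: Z_def)
  have ZA: "A * t \<le> Z t" if "0 \<le> t" "t \<le> 1" for t
  proof -
    have "integral {0..t} (\<lambda>_. A) \<le> Z t"
      unfolding Z_def using that iv C by (intro integral_le) (auto simp: v_def)
    then show ?thesis using that by (simp add: mult.commute)
  qed
  have vZ: "v t \<le> A + C * rpow (Z t) a" if "0 \<le> t" "t \<le> 1" for t
    using le[OF that] C a nonneg unfolding v_def Z_def
    by (intro add_left_mono mult_left_mono rpow_mono) auto
  have Zpos: "0 < Z t" if "0 < t" "t \<le> 1" for t
    using ZA[of t] A that by (smt (verit) mult_pos_pos)
  have "\<phi> 1 \<le> Z 1" using le[of 1] by (simp add: Z_def v_def)
  also have "Z 1 \<le> (if a = 1 then A * exp C
                  else (A powr (1 - a) + (1 - a) * C) powr (1 / (1 - a)))"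
  proof (cases "a = 1")
    case True
    \<comment> \<open>The integrating factor of the linear case: \<open>v t - C * Z t\<close> is at
      most \<open>A\<close> and the factor at most 1, so
      \<open>exp (- C) * Z 1 \<le> A\<close>.\<close>
    let ?F = "\<lambda>t. exp (- (C * t)) * Z t - A * t"
    have "?F 0 \<ge> ?F 1"
    proof (rule DERIV_nonpos_imp_decreasing_open[where f = ?F])
      fix t :: real assume t: "0 < t" "t < 1"
      have *: "(?F has_real_derivative exp (- (C * t)) * (v t - C * Z t) - A) (at t)"
        using t by (auto intro!: derivative_eq_intros dZ simp: algebra_simps)
      have "v t - C * Z t \<le> A"
        using vZ[of t] Zpos[of t] t True by (simp add: rpow_def)
      then have "exp (- (C * t)) * (v t - C * Z t) \<le> exp (- (C * t)) * A"
        by (intro mult_left_mono) auto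
      also have "\<dots> \<le> A"
        using A C t by (intro mult_left_le_one_le) auto
      finally show "\<exists>y. DERIV ?F t :> y \<and> y \<le> 0" using * by (intro exI conjI) auto
    qed (auto intro!: continuous_intros cZ)
    then show ?thesis using True Z0 by (simp add: exp_minus field_simps)
  next
    case False
    then have a1: "a < 1" using a by simp
    let ?F = "\<lambda>t. Z t powr (1 - a) - (A * t) powr (1 - a) - (1 - a) * C * t"
    have "?F 0 \<ge> ?F 1"
    \<comment> \<open>Both \<open>Z t\<close> and \<open>A * t\<close> vanish at 0, where their
      powers need not be differentiable; hence derivatives on the open interval and only continuity
      at the ends.\<close>
    proof (rule DERIV_nonpos_imp_decreasing_open[where f = ?F])
      fix t :: real assume t: "0 < t" "t < 1"
      have Zt: "0 < Z t" and At: "0 < A * t" using Zpos t A by auto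
      let ?y = "(1 - a) * (Z t powr (- a) * v t - (A * t) powr (- a) * A - C)"
      have "(?F has_real_derivative ?y) (at t)"
        using t Zt At by (auto intro!: derivative_eq_intros dZ simp: algebra_simps)
      moreover have "Z t powr (- a) * v t \<le> Z t powr (- a) * A + C"
      proof -
        have "Z t powr (- a) * v t \<le> Z t powr (- a) * (A + C * Z t powr a)"
          using vZ[of t] t Zt by (intro mult_left_mono) (auto simp: rpow_eq_powr)
        also have "\<dots> = Z t powr (- a) * A + C"
          using Zt by (simp add: powr_minus field_simps)
        finally show ?thesis .
      qed
      moreover have "Z t powr (- a) * A \<le> (A * t) powr (- a) * A"
        using ZA[of t] t A At a by (intro mult_right_mono powr_mono2') auto
      ultimately have "?y \<le> 0" using a1 by (intro mult_nonneg_nonpos) auto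
      then show "\<exists>y. DERIV ?F t :> y \<and> y \<le> 0"
        using \<open>(?F has_real_derivative ?y) (at t)\<close> by blast
    next
      have "0 \<le> Z t" if "0 \<le> t" "t \<le> 1" for t
        using Zpos[of t] Z0 that by (cases "t = 0") auto
      then show "continuous_on {0..1} ?F"
        using A a1 by (intro continuous_intros continuous_on_powr' cZ) auto
    qed simp
    then have "Z 1 powr (1 - a) \<le> A powr (1 - a) + (1 - a) * C" using Z0 by simp
    then have "(Z 1 powr (1 - a)) powr (1 / (1 - a))
        \<le> (A powr (1 - a) + (1 - a) * C) powr (1 / (1 - a))"
      using a1 by (intro powr_mono2) auto
    then show ?thesis using Zpos[of 1] a1 by (simp add: powr_powr)
  qed
  finally show ?thesis .
qed

section \<open>Gradients and the tangent inequality of convex functions\<close>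

text \<open>Justifies the definite description in \<open>grad\<close>: the Riesz vector of the
  derivative \<open>D\<close> is \<open>adjoint D 1\<close>, and uniqueness of derivatives makes it
  the only candidate.\<close>

lemma gderiv_grad:
  fixes f :: "'a::euclidean_space \<Rightarrow> real"
  assumes "f differentiable (at x)"
  shows "GDERIV f x :> grad f x"
proof -
  obtain D where D: "(f has_derivative D) (at x)" using assms by (auto simp: differentiable_def)
  have lin: "linear D" using D has_derivative_linear by blast
  have "D = (\<lambda>h. h \<bullet> adjoint D 1)" using adjoint_works[OF lin, of _ 1] by (auto simp: fun_eq_iff)
  then have G: "GDERIV f x :> adjoint D 1" using D by (simp add: gderiv_def)
  have "E = adjoint D 1" if "GDERIV f x :> E" for E
    using has_derivative_unique[OF that[unfolded gderiv_def] G[unfolded gderiv_def]]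
    by (metis (no_types) vector_eq_rdot inner_commute)
  then show ?thesis unfolding grad_def using G by (metis the_equality)
qed

lemma grad_segment_deriv:
  fixes f :: "'a::euclidean_space \<Rightarrow> real"
  assumes "f differentiable (at (x + t *\<^sub>R v))"
  shows "((\<lambda>t. f (x + t *\<^sub>R v)) has_real_derivative grad f (x + t *\<^sub>R v) \<bullet> v) (at t)"
proof -
  have "((\<lambda>t. f (x + t *\<^sub>R v)) has_derivative (\<lambda>h. (h *\<^sub>R v) \<bullet> grad f (x + t *\<^sub>R v))) (at t)"
    by (rule has_derivative_compose[where f = "\<lambda>t. x + t *\<^sub>R v",
          OF _ gderiv_grad[OF assms, unfolded gderiv_def]])
       (auto intro!: derivative_eq_intros)
  then show ?thesis
    by (simp add: has_field_derivative_def inner_commute mult.commute[of _ "_ \<bullet> _"])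
qed

text \<open>Restricting to the line through \<open>x\<close> and \<open>y\<close> reduces this to
  the tangent at 0 of a convex function of one real variable, compared with its value at 1.\<close>

lemma convex_grad_ineq:
  fixes f :: "'a::euclidean_space \<Rightarrow> real"
  assumes "convex_on UNIV f" "f differentiable (at x)"
  shows "f x + grad f x \<bullet> (y - x) \<le> f y"
proof -
  let ?p = "\<lambda>t::real. f (x + t *\<^sub>R (y - x))"
  have "convex_on UNIV ?p"
  proof (rule convex_onI)
    fix t u w :: real assume t: "0 < t" "t < 1"
    have "x + ((1 - t) *\<^sub>R u + t *\<^sub>R w) *\<^sub>R (y - x)
        = (1 - t) *\<^sub>R (x + u *\<^sub>R (y - x)) + t *\<^sub>R (x + w *\<^sub>R (y - x))"
      by (simp add: algebra_simps)
    then show "?p ((1 - t) *\<^sub>R u + t *\<^sub>R w) \<le> (1 - t) * ?p u + t * ?p w"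
      using convex_onD[OF assms(1), of t "x + u *\<^sub>R (y - x)" "x + w *\<^sub>R (y - x)"] t by auto
  qed auto
  moreover have "(?p has_real_derivative grad f x \<bullet> (y - x)) (at 0)"
    using grad_segment_deriv[of f x 0 "y - x"] assms by simp
  ultimately have "grad f x \<bullet> (y - x) * (1 - 0) \<le> ?p 1 - ?p 0"
    by (intro convex_on_imp_above_tangent[where A = UNIV]) auto
  then show ?thesis by simp
qed

section \<open>Generalized smoothness: growth of the gradient and descent\<close>

text \<open>Smoothness is applied on every initial segment from \<open>x\<close> to
  \<open>x + t *\<^sub>R v\<close>. Subadditivity of the power splits off the gradient at
  \<open>x\<close>, which leaves the hypothesis of \<open>rpow_gronwall\<close> with
  \<open>A = r * d\<close> and \<open>C = r * L\<^sub>1\<close>.\<close>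

lemma gen_smooth_grad_growth:
  fixes f :: "'a::euclidean_space \<Rightarrow> real"
  assumes C1: "continuously_differentiable f" and sm: "gen_smooth \<alpha> L\<^sub>0 L\<^sub>1 f"
    and a: "0 \<le> \<alpha>" "\<alpha> \<le> 1" and L: "0 \<le> L\<^sub>1"
    and D: "0 < L\<^sub>0 + L\<^sub>1 * rpow (norm (grad f x)) \<alpha>"
  shows "norm (grad f (x + v) - grad f x)
    \<le> (L\<^sub>0 + L\<^sub>1 * rpow (norm (grad f x)) \<alpha>) * norm v * g_aux \<alpha> L\<^sub>0 L\<^sub>1 (norm v) (norm (grad f x))"
proof (cases "v = 0")
  case False
  define r where "r = norm v"
  define d where "d = L\<^sub>0 + L\<^sub>1 * rpow (norm (grad f x)) \<alpha>"
  define \<phi> where "\<phi> = (\<lambda>t. norm (grad f (x + t *\<^sub>R v) - grad f x))"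
  define U where "U = (\<lambda>t. rpow (norm (grad f (x + t *\<^sub>R v))) \<alpha>)"
  have r: "0 < r" using False by (simp add: r_def)
  have d: "0 < d" using D by (simp add: d_def)
  have cg: "continuous_on S (\<lambda>t. grad f (x + t *\<^sub>R v))" for S :: "real set"
    by (rule continuous_on_compose2[of UNIV "grad f" S "\<lambda>t. x + t *\<^sub>R v"])
       (use C1 in \<open>auto simp: continuously_differentiable_def intro!: continuous_intros\<close>)
  have c\<phi>: "continuous_on S \<phi>" for S
    unfolding \<phi>_def by (intro continuous_intros cg)
  have cU: "continuous_on S U" for S
    unfolding U_def by (intro continuous_on_rpow continuous_intros cg) (use a in auto)
  have le: "\<phi> t \<le> integral {0..t} (\<lambda>\<tau>. r * d + r * L\<^sub>1 * rpow (\<phi> \<tau>) \<alpha>)"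
    if t: "0 \<le> t" "t \<le> 1" for t
  proof (cases "t = 0")
    case False
    then have t0: "t > 0" using t by simp
    have im: "(\<lambda>x. x / t) ` {0..t} = {0..1}"
      using t0 by (auto simp: image_iff field_simps intro!: bexI[of _ "t * _"])
    have "\<phi> t \<le> (L\<^sub>0 + L\<^sub>1 * integral {0..1} (\<lambda>\<tau>. U (t * \<tau>))) * (t * r)"
      using sm[unfolded gen_smooth_def, THEN conjunct2, rule_format, of x "x + t *\<^sub>R v"] t
      by (simp add: \<phi>_def U_def r_def norm_minus_commute mult.commute)
    \<comment> \<open>Rescaling the variable moves the integral to \<open>{0..t}\<close>; the
      resulting factor \<open>1 / t\<close> cancels against the segment length
      \<open>t * r\<close>.\<close>
    also have "integral {0..1} (\<lambda>\<tau>. U (t * \<tau>)) = integral {0..t} U / t"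
      using integral_stretch_real[of t 0 t U] t0 unfolding im by simp
    also have "(L\<^sub>0 + L\<^sub>1 * (integral {0..t} U / t)) * (t * r)
        = integral {0..t} (\<lambda>_. r * L\<^sub>0) + integral {0..t} (\<lambda>\<tau>. r * L\<^sub>1 * U \<tau>)"
      using t0 by (simp add: field_simps)
    also have "\<dots> = integral {0..t} (\<lambda>\<tau>. r * L\<^sub>0 + r * L\<^sub>1 * U \<tau>)"
      by (intro integral_add[symmetric] integrable_continuous_real continuous_intros cU)
    also have "\<dots> \<le> integral {0..t} (\<lambda>\<tau>. r * d + r * L\<^sub>1 * rpow (\<phi> \<tau>) \<alpha>)"
    proof (intro integral_le integrable_continuous_real continuous_intros cU continuous_on_rpow c\<phi>)
      fix \<tau>
      have "norm (grad f (x + \<tau> *\<^sub>R v)) \<le> norm (grad f x) + \<phi> \<tau>"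
        unfolding \<phi>_def using norm_triangle_ineq[of "grad f x" "grad f (x + \<tau> *\<^sub>R v) - grad f x"]
        by simp
      then have "U \<tau> \<le> rpow (norm (grad f x) + \<phi> \<tau>) \<alpha>"
        unfolding U_def using a by (intro rpow_mono) auto
      also have "\<dots> \<le> rpow (norm (grad f x)) \<alpha> + rpow (\<phi> \<tau>) \<alpha>"
        using a by (intro rpow_add_le) (auto simp: \<phi>_def)
      finally have "r * (L\<^sub>0 + L\<^sub>1 * U \<tau>) \<le> r * (L\<^sub>0 + L\<^sub>1 * (rpow (norm (grad f x)) \<alpha> + rpow (\<phi> \<tau>) \<alpha>))"
        using L r by (intro mult_left_mono add_left_mono) auto
      then show "r * L\<^sub>0 + r * L\<^sub>1 * U \<tau> \<le> r * d + r * L\<^sub>1 * rpow (\<phi> \<tau>) \<alpha>"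
        by (simp add: d_def algebra_simps)
    qed (use a in \<open>auto simp: \<phi>_def\<close>)
    finally show ?thesis .
  qed (simp add: \<phi>_def)
  have "\<phi> 1 \<le> (if \<alpha> = 1 then r * d * exp (r * L\<^sub>1)
        else ((r * d) powr (1 - \<alpha>) + (1 - \<alpha>) * (r * L\<^sub>1)) powr (1 / (1 - \<alpha>)))"
    by (rule rpow_gronwall[OF c\<phi>]) (use r d L a le in \<open>auto simp: \<phi>_def\<close>)
  also have "\<dots> = d * r * g_aux \<alpha> L\<^sub>0 L\<^sub>1 r (norm (grad f x))"
  proof (cases "\<alpha> = 1")
    case False
    let ?P = "1 + (1 - \<alpha>) * L\<^sub>1 * r powr \<alpha> / d powr (1 - \<alpha>)"
    \<comment> \<open>Splitting \<open>r\<close> this way allows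
      \<open>(r * d) powr (1 - \<alpha>)\<close> to be factored out, and what remains is the base of
      \<open>g_aux\<close>.\<close>
    have "r powr (1 - \<alpha>) * r powr \<alpha> = r"
      using r by (simp add: powr_add[symmetric])
    then have "(r * d) powr (1 - \<alpha>) + (1 - \<alpha>) * (r * L\<^sub>1)
        = (r * d) powr (1 - \<alpha>) + (1 - \<alpha>) * L\<^sub>1 * (r powr (1 - \<alpha>) * r powr \<alpha>)"
      by simp
    also have "\<dots> = (r * d) powr (1 - \<alpha>) * ?P"
      using r d by (simp add: powr_mult field_simps)
    finally have "((r * d) powr (1 - \<alpha>) + (1 - \<alpha>) * (r * L\<^sub>1)) powr (1 / (1 - \<alpha>))
        = ((r * d) powr (1 - \<alpha>)) powr (1 / (1 - \<alpha>)) * ?P powr (1 / (1 - \<alpha>))"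
      using r d a L by (simp add: powr_mult)
    also have "((r * d) powr (1 - \<alpha>)) powr (1 / (1 - \<alpha>)) = r * d"
      using r d False by (simp add: powr_powr)
    finally show ?thesis
      using False r by (simp add: g_aux_def d_def rpow_eq_powr)
  qed (simp add: g_aux_def mult.commute)
  finally show ?thesis by (simp add: \<phi>_def d_def r_def)
qed simp

lemma g_aux_ge_1:
  assumes "0 \<le> \<alpha>" "\<alpha> \<le> 1" "0 \<le> L\<^sub>1" "0 \<le> a"
  shows "1 \<le> g_aux \<alpha> L\<^sub>0 L\<^sub>1 a b"
  using assms by (auto simp: g_aux_def intro!: ge_one_powr_ge_zero)

lemma g_aux_mono:
  assumes "0 \<le> \<alpha>" "\<alpha> \<le> 1" "0 \<le> L\<^sub>1" "0 \<le> a" "a \<le> a'"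
  shows "g_aux \<alpha> L\<^sub>0 L\<^sub>1 a b \<le> g_aux \<alpha> L\<^sub>0 L\<^sub>1 a' b"
  using assms
  by (auto simp: g_aux_def intro!: powr_mono2 add_left_mono divide_right_mono mult_left_mono rpow_mono)

text \<open>The function minus its claimed quadratic bound is nonincreasing along the segment.
  Monotonicity replaces \<open>g_aux\<close> at \<open>norm (t *\<^sub>R v)\<close> by its value at
  \<open>norm v\<close>, so the derivative bound is linear in \<open>t\<close> and integrates to the
  factor 1/2.\<close>

lemma descent_inequality:
  fixes f :: "'a::euclidean_space \<Rightarrow> real"
  assumes C1: "continuously_differentiable f" and sm: "gen_smooth \<alpha> L\<^sub>0 L\<^sub>1 f"
    and a: "0 \<le> \<alpha>" "\<alpha> \<le> 1" and L: "0 \<le> L\<^sub>1"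
    and D: "0 < L\<^sub>0 + L\<^sub>1 * rpow (norm (grad f x)) \<alpha>"
  shows "f (x + v) \<le> f x + grad f x \<bullet> v
    + (L\<^sub>0 + L\<^sub>1 * rpow (norm (grad f x)) \<alpha>) * g_aux \<alpha> L\<^sub>0 L\<^sub>1 (norm v) (norm (grad f x)) * (norm v)\<^sup>2 / 2"
proof -
  define K where "K = (L\<^sub>0 + L\<^sub>1 * rpow (norm (grad f x)) \<alpha>) * g_aux \<alpha> L\<^sub>0 L\<^sub>1 (norm v) (norm (grad f x))"
  let ?F = "\<lambda>t::real. f (x + t *\<^sub>R v) - t * (grad f x \<bullet> v) - K * (norm v)\<^sup>2 * t\<^sup>2 / 2"
  have "?F 0 \<ge> ?F 1"
  proof (rule DERIV_nonpos_imp_nonincreasing[where f = ?F])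
    fix t :: real assume t: "0 \<le> t" "t \<le> 1"
    let ?y = "grad f (x + t *\<^sub>R v) \<bullet> v - grad f x \<bullet> v - K * (norm v)\<^sup>2 * t"
    have "(?F has_real_derivative ?y) (at t)"
      using C1 by (auto intro!: derivative_eq_intros grad_segment_deriv
          simp: continuously_differentiable_def)
    moreover have "grad f (x + t *\<^sub>R v) \<bullet> v - grad f x \<bullet> v \<le> K * (norm v)\<^sup>2 * t"
    proof -
      have "grad f (x + t *\<^sub>R v) \<bullet> v - grad f x \<bullet> v \<le> norm (grad f (x + t *\<^sub>R v) - grad f x) * norm v"
        by (metis inner_diff_left norm_cauchy_schwarz)
      also have "\<dots> \<le> ((L\<^sub>0 + L\<^sub>1 * rpow (norm (grad f x)) \<alpha>) * norm (t *\<^sub>R v)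
            * g_aux \<alpha> L\<^sub>0 L\<^sub>1 (norm (t *\<^sub>R v)) (norm (grad f x))) * norm v"
        by (intro mult_right_mono gen_smooth_grad_growth[OF C1 sm a L D]) auto
      also have "\<dots> \<le> ((L\<^sub>0 + L\<^sub>1 * rpow (norm (grad f x)) \<alpha>) * norm (t *\<^sub>R v)
            * g_aux \<alpha> L\<^sub>0 L\<^sub>1 (norm v) (norm (grad f x))) * norm v"
        using t D a L by (intro mult_right_mono mult_left_mono g_aux_mono) (auto simp: mult_left_le_one_le)
      also have "\<dots> = K * (norm v)\<^sup>2 * t"
        using t by (simp add: K_def power2_eq_square)
      finally show ?thesis .
    qed
    ultimately show "\<exists>y. DERIV ?F t :> y \<and> y \<le> 0" by (intro exI[of _ ?y]) auto
  qed simp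
  then show ?thesis by (simp add: K_def algebra_simps)
qed

section \<open>The function \<open>h_aux\<close> and its lower bound\<close>

text \<open>Justifies the definite description in \<open>h_aux\<close>: since \<open>g_aux\<close>
  is at least 1, the intermediate value theorem on \<open>{0..t}\<close> gives a solution, and
  strict monotonicity makes it unique.\<close>

lemma h_aux_props:
  assumes a: "0 \<le> \<alpha>" "\<alpha> \<le> 1" and L: "0 \<le> L\<^sub>1" and t: "0 < t"
  shows "0 < h_aux \<alpha> L\<^sub>0 L\<^sub>1 b t"
    and "h_aux \<alpha> L\<^sub>0 L\<^sub>1 b t * g_aux \<alpha> L\<^sub>0 L\<^sub>1 (h_aux \<alpha> L\<^sub>0 L\<^sub>1 b t) b = t"
proof -
  let ?F = "\<lambda>y. y * g_aux \<alpha> L\<^sub>0 L\<^sub>1 y b"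
  have strict: "?F y < ?F z" if "0 < y" "y < z" for y z
  proof -
    have "y * g_aux \<alpha> L\<^sub>0 L\<^sub>1 y b < z * g_aux \<alpha> L\<^sub>0 L\<^sub>1 y b"
      using that g_aux_ge_1[OF a L, of y L\<^sub>0 b] by (intro mult_strict_right_mono) auto
    also have "\<dots> \<le> ?F z"
      using that by (intro mult_left_mono g_aux_mono a L) auto
    finally show ?thesis .
  qed
  have "continuous_on {0..t} (\<lambda>y. g_aux \<alpha> L\<^sub>0 L\<^sub>1 y b)"
  proof (cases "\<alpha> = 1")
    case True
    then show ?thesis by (auto simp: g_aux_def intro!: continuous_intros)
  next
    case False
    have "0 < 1 + (1 - \<alpha>) * L\<^sub>1 * rpow y \<alpha> / (L\<^sub>0 + L\<^sub>1 * rpow b \<alpha>) powr (1 - \<alpha>)" for y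
      using a L by (intro add_pos_nonneg) auto
    then have nz: "1 + (1 - \<alpha>) * L\<^sub>1 * rpow y \<alpha> / (L\<^sub>0 + L\<^sub>1 * rpow b \<alpha>) powr (1 - \<alpha>) \<noteq> 0" for y
      by (metis less_irrefl)
    \<comment> \<open>If the denominator is 0, the quotient is 0 by convention and
      \<open>g_aux\<close> is constant in \<open>y\<close>.\<close>
    then show ?thesis
      using False a by (cases "(L\<^sub>0 + L\<^sub>1 * rpow b \<alpha>) powr (1 - \<alpha>) = 0")
        (auto simp: g_aux_def intro!: continuous_intros continuous_on_rpow)
  qed
  then have "continuous_on {0..t} ?F" by (intro continuous_intros)
  moreover have "t * 1 \<le> ?F t"
    using t by (intro mult_left_mono g_aux_ge_1 a L) auto
  ultimately obtain y where y: "0 \<le> y" "?F y = t"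
    using IVT'[of ?F 0 t t] t by auto
  then have "0 < y" using t by (cases "y = 0") auto
  have "0 < h_aux \<alpha> L\<^sub>0 L\<^sub>1 b t \<and> ?F (h_aux \<alpha> L\<^sub>0 L\<^sub>1 b t) = t"
    unfolding h_aux_def
  proof (rule theI)
    show "0 < y \<and> ?F y = t" using y \<open>0 < y\<close> by simp
    show "z = y" if "0 < z \<and> ?F z = t" for z
      using that \<open>0 < y\<close> y strict[of z y] strict[of y z] by (cases z y rule: linorder_cases) auto
  qed
  then show "0 < h_aux \<alpha> L\<^sub>0 L\<^sub>1 b t" "?F (h_aux \<alpha> L\<^sub>0 L\<^sub>1 b t) = t" by auto
qed

text \<open>The numbers \<open>1 + (1 - \<alpha>) * z\<close> and \<open>1 - \<alpha> * z\<close>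
  have mean 1 under the weights \<open>\<alpha>\<close> and \<open>1 - \<alpha>\<close>. AM-GM
  bounds their weighted product by 1, and the power \<open>1 / (1 - \<alpha>)\<close> normalizes the
  second exponent.\<close>

lemma powr_one_minus_bound:
  fixes z :: real
  assumes a: "0 \<le> \<alpha>" "\<alpha> < 1" and z: "0 \<le> z"
  shows "(1 + (1 - \<alpha>) * z) powr (\<alpha> / (1 - \<alpha>)) * (1 - \<alpha> * z) \<le> 1"
proof (cases "0 < 1 - \<alpha> * z")
  case True
  let ?p = "1 + (1 - \<alpha>) * z"
  have p: "0 < ?p" using a z by (intro add_pos_nonneg) auto
  have "?p powr \<alpha> * (1 - \<alpha> * z) powr (1 - \<alpha>) \<le> \<alpha> * ?p + (1 - \<alpha>) * (1 - \<alpha> * z)"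
    using Youngs_inequality_0[of \<alpha> "1 - \<alpha>" ?p "1 - \<alpha> * z"] a p True by simp
  also have "\<dots> = 1" by (simp add: algebra_simps)
  finally have "(?p powr \<alpha> * (1 - \<alpha> * z) powr (1 - \<alpha>)) powr (1 / (1 - \<alpha>)) \<le> 1 powr (1 / (1 - \<alpha>))"
    using a by (intro powr_mono2) auto
  then show ?thesis using a p True by (simp add: powr_mult powr_powr)
next
  case False
  then show ?thesis by (smt (verit) mult_nonneg_nonpos powr_ge_zero)
qed

text \<open>
  With \<open>h * g = c * b / d\<close> the claim becomes \<open>g \<le> 1 + z * g powr \<alpha>\<close>; splitting
  \<open>g = g powr (1 - \<alpha>) * g powr \<alpha>\<close> turns this into the weighted AM-GM bound above.
\<close>

lemma h_aux_lower_bound: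
  assumes a: "0 \<le> \<alpha>" "\<alpha> \<le> 1" and L: "0 \<le> L\<^sub>0" "0 \<le> L\<^sub>1" "0 < L\<^sub>0 \<or> 0 < L\<^sub>1"
    and b: "0 < b" and c: "0 < c"
  shows "c * b / (L\<^sub>0 + L\<^sub>1 * (1 + c powr \<alpha>) * rpow b \<alpha>) \<le> h_aux \<alpha> L\<^sub>0 L\<^sub>1 b (c * psi_aux \<alpha> L\<^sub>0 L\<^sub>1 b)"
proof -
  define d where "d = L\<^sub>0 + L\<^sub>1 * rpow b \<alpha>"
  have d: "0 < d" unfolding d_def by (rule linear_rpow_pos[OF L b])
  define h where "h = h_aux \<alpha> L\<^sub>0 L\<^sub>1 b (c * psi_aux \<alpha> L\<^sub>0 L\<^sub>1 b)"
  define g where "g = g_aux \<alpha> L\<^sub>0 L\<^sub>1 h b"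
  have psi: "psi_aux \<alpha> L\<^sub>0 L\<^sub>1 b = b / d" by (simp add: psi_aux_def d_def)
  have h: "0 < h" "h * g = c * b / d"
    using h_aux_props[of \<alpha> L\<^sub>1 "c * (b / d)" L\<^sub>0 b] a L b c d
    by (auto simp: h_def g_def psi)
  have g1: "1 \<le> g" unfolding g_def using a L h by (intro g_aux_ge_1) auto
  have "d * g \<le> d + L\<^sub>1 * c powr \<alpha> * b powr \<alpha>"
  proof (cases "\<alpha> = 1")
    case True
    \<comment> \<open>The exponential counterpart of the AM-GM bound.\<close>
    have "1 - L\<^sub>1 * h \<le> exp (- (L\<^sub>1 * h))" using exp_ge_add_one_self[of "- (L\<^sub>1 * h)"] by simp
    then have "exp (L\<^sub>1 * h) * (1 - L\<^sub>1 * h) \<le> exp (L\<^sub>1 * h) * exp (- (L\<^sub>1 * h))"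
      by (intro mult_left_mono) auto
    then have "g \<le> 1 + L\<^sub>1 * (h * g)"
      using True by (simp add: g_def g_aux_def exp_minus algebra_simps)
    then have "d * g \<le> d * (1 + L\<^sub>1 * (c * b / d))" unfolding h(2) using d by (intro mult_left_mono) auto
    then show ?thesis using True d b c by (simp add: algebra_simps)
  next
    case False
    then have a1: "\<alpha> < 1" using a by simp
    define z where "z = L\<^sub>1 * h powr \<alpha> / d powr (1 - \<alpha>)"
    have z: "0 \<le> z" using L by (simp add: z_def)
    have ge: "g = (1 + (1 - \<alpha>) * z) powr (1 / (1 - \<alpha>))"
      using False h by (simp add: g_def g_aux_def z_def d_def rpow_eq_powr mult.assoc)
    have p: "0 < 1 + (1 - \<alpha>) * z" using a1 z by (intro add_pos_nonneg) auto
    have ga: "g powr \<alpha> = (1 + (1 - \<alpha>) * z) powr (\<alpha> / (1 - \<alpha>))"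
      by (simp add: ge powr_powr)
    have "1 / (1 - \<alpha>) = \<alpha> / (1 - \<alpha>) + 1" using a1 by (simp add: field_simps)
    then have "g = (1 + (1 - \<alpha>) * z) powr (\<alpha> / (1 - \<alpha>)) * (1 + (1 - \<alpha>) * z)"
      using p by (simp add: ge powr_add)
    also have "\<dots> = g powr \<alpha> * (1 + (1 - \<alpha>) * z)"
      by (simp add: ga)
    also have "\<dots> = g powr \<alpha> * (1 - \<alpha> * z) + z * g powr \<alpha>"
      by (simp add: algebra_simps)
    also have "\<dots> \<le> 1 + z * g powr \<alpha>"
      using powr_one_minus_bound[OF a(1) a1 z] ga by simp
    finally have "d * g \<le> d * (1 + z * g powr \<alpha>)" using d by (intro mult_left_mono) auto
    also have "d * (1 + z * g powr \<alpha>) = d + d * L\<^sub>1 * (h * g) powr \<alpha> / d powr (1 - \<alpha>)"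
      using h(1) g1 by (simp add: z_def powr_mult ring_distribs mult_ac)
    \<comment> \<open>With \<open>h * g = c * b / d\<close> inserted, the exponents of
      \<open>d\<close> add up to \<open>1 - \<alpha> - (1 - \<alpha>) = 0\<close>.\<close>
    also have "\<dots> = d + L\<^sub>1 * c powr \<alpha> * b powr \<alpha>"
      unfolding h(2) using d b c by (simp add: powr_mult powr_divide powr_diff)
    finally show ?thesis .
  qed
  then have le: "d * g \<le> L\<^sub>0 + L\<^sub>1 * (1 + c powr \<alpha>) * rpow b \<alpha>"
    using b by (simp add: d_def rpow_eq_powr algebra_simps)
  have dg: "0 < d * g" using d g1 by simp
  have "0 < (L\<^sub>0 + L\<^sub>1 * (1 + c powr \<alpha>) * rpow b \<alpha>) * (d * g)"
    by (rule mult_pos_pos[OF less_le_trans[OF dg le] dg])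
  with le have "c * b / (L\<^sub>0 + L\<^sub>1 * (1 + c powr \<alpha>) * rpow b \<alpha>) \<le> c * b / (d * g)"
    using b c by (intro divide_left_mono) auto
  also have "\<dots> = h" using h d g1 by (simp add: field_simps)
  finally show ?thesis by (simp add: h_def)
qed

text \<open>After cross-multiplication only
  \<open>v powr (\<alpha> - 1) \<le> u powr (\<alpha> - 1)\<close> matters. This carries the bound
  on \<open>h_aux\<close> from gradient norms over to smaller numbers.\<close>

lemma quotient_rpow_mono:
  fixes P Q :: real
  assumes a: "0 \<le> \<alpha>" "\<alpha> \<le> 1" and PQ: "0 \<le> P" "0 \<le> Q" "0 < P \<or> 0 < Q"
    and uv: "0 < u" "u \<le> v"
  shows "u / (P + Q * rpow u \<alpha>) \<le> v / (P + Q * rpow v \<alpha>)"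
proof -
  have v: "0 < v" using uv by simp
  have e: "rpow y \<alpha> = y * y powr (\<alpha> - 1)" if "0 < y" for y
    using that by (simp add: rpow_eq_powr powr_diff)
  have "v powr (\<alpha> - 1) \<le> u powr (\<alpha> - 1)" using uv a by (intro powr_mono2') auto
  then have "u * v * Q * v powr (\<alpha> - 1) \<le> u * v * Q * u powr (\<alpha> - 1)"
    using uv v PQ by (intro mult_left_mono) auto
  moreover have "u * P \<le> v * P" using uv PQ by (intro mult_right_mono) auto
  ultimately have "u * (P + Q * rpow v \<alpha>) \<le> v * (P + Q * rpow u \<alpha>)"
    using e[OF uv(1)] e[OF v] by (simp add: algebra_simps)
  then show ?thesis using linear_rpow_pos[OF PQ uv(1)] linear_rpow_pos[OF PQ v] by (simp add: field_simps)
qed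

section \<open>A single trust-region iteration\<close>

lemma matrix_norm_nonneg: "0 \<le> matrix_norm B"
  unfolding matrix_norm_def by (intro onorm_pos_le matrix_vector_mul_bounded_linear)

lemma matrix_norm_pos: "B \<noteq> 0 \<Longrightarrow> 0 < matrix_norm B"
  unfolding matrix_norm_def
  by (subst onorm_pos_lt) (auto simp: matrix_eq)

lemma cauchy_length_ge:
  assumes "q \<le> D" and "matrix_norm B \<le> M" and "0 < M" and "q \<le> norm (grad f x) / M"
  shows "q \<le> cauchy_length f x B D"
proof (cases "B = 0")
  case False
  then have "norm (grad f x) / M \<le> norm (grad f x) / matrix_norm B"
    using assms matrix_norm_pos[OF False] by (intro divide_left_mono mult_pos_pos) auto
  then show ?thesis using assms False by (simp add: cauchy_length_def)
qed (use assms in \<open>simp add: cauchy_length_def\<close>)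

text \<open>A vanishing predicted decrease would make the ratio 0 by division by zero; a ratio of at
  least \<open>\<eta> > 0\<close> therefore forces a positive one.\<close>

lemma tr_ratio_decrease:
  assumes "\<eta> \<le> tr_ratio f x B s" "0 < \<eta>" "0 \<le> q" "q \<le> tr_model f x B 0 - tr_model f x B s"
  shows "\<eta> * q \<le> f x - f (x + s)"
proof -
  let ?p = "tr_model f x B 0 - tr_model f x B s"
  have p: "0 < ?p" using assms by (cases "?p = 0") (auto simp: tr_ratio_def)
  have "\<eta> * q \<le> tr_ratio f x B s * ?p" using assms p by (intro mult_mono) auto
  then show ?thesis using p by (simp add: tr_ratio_def)
qed

text \<open>A step of length \<open>r \<le> h\<close> satisfies
  \<open>r * g r \<le> h * g h = c * b / d\<close>. The function then exceeds the model by at most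
  \<open>c * b * D = (1 - \<eta>) * (\<kappa> * b * D)\<close>, which is at most the share
  \<open>1 - \<eta>\<close> of the predicted decrease.\<close>

lemma very_successful_if_small_radius:
  fixes f :: "real^'n \<Rightarrow> real"
  assumes C1: "continuously_differentiable f" and sm: "gen_smooth \<alpha> L\<^sub>0 L\<^sub>1 f"
    and a: "0 \<le> \<alpha>" "\<alpha> \<le> 1" and L: "0 \<le> L\<^sub>0" "0 \<le> L\<^sub>1"
    and const: "0 < \<kappa>" "\<kappa> \<le> 1" "0 < \<eta>" "\<eta> < 1"
    and G: "0 < norm (grad f x)"
    and B: "matrix_norm B \<le> L\<^sub>0 + L\<^sub>1 * rpow (norm (grad f x)) \<alpha>"
    and D: "0 < D" "norm s \<le> D"
    and dec: "\<kappa> * norm (grad f x) * cauchy_length f x B D \<le> tr_model f x B 0 - tr_model f x B s"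
    and small: "D \<le> h_aux \<alpha> L\<^sub>0 L\<^sub>1 (norm (grad f x)) (\<kappa> * (1 - \<eta>) * psi_aux \<alpha> L\<^sub>0 L\<^sub>1 (norm (grad f x)))"
  shows "\<eta> \<le> tr_ratio f x B s"
proof -
  define b where "b = norm (grad f x)"
  define d where "d = L\<^sub>0 + L\<^sub>1 * rpow b \<alpha>"
  define c where "c = \<kappa> * (1 - \<eta>)"
  define r where "r = norm s"
  define h where "h = h_aux \<alpha> L\<^sub>0 L\<^sub>1 b (c * psi_aux \<alpha> L\<^sub>0 L\<^sub>1 b)"
  define p where "p = tr_model f x B 0 - tr_model f x B s"
  let ?g = "\<lambda>y. g_aux \<alpha> L\<^sub>0 L\<^sub>1 y b"
  have L': "0 < L\<^sub>0 \<or> 0 < L\<^sub>1" using sm by (simp add: gen_smooth_def)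
  have b: "0 < b" using G by (simp add: b_def)
  have c: "0 < c" "c \<le> 1" using const by (auto simp: c_def intro: mult_le_one)
  have d: "0 < d" unfolding d_def by (rule linear_rpow_pos[OF L L' b])
  have psi: "psi_aux \<alpha> L\<^sub>0 L\<^sub>1 b = b / d" by (simp add: psi_aux_def d_def)
  have h: "0 < h" "h * ?g h = c * (b / d)"
    using h_aux_props[of \<alpha> L\<^sub>1 "c * (b / d)" L\<^sub>0 b] a L b c d by (auto simp: h_def psi)
  have Dh: "D \<le> h" using small by (simp add: h_def b_def c_def)
  have r: "0 \<le> r" "r \<le> D" using D by (auto simp: r_def)
  have gh: "1 \<le> ?g h" using g_aux_ge_1 a L h by auto
  have gr: "1 \<le> ?g r" using g_aux_ge_1 a L r by auto
  have "r * ?g r \<le> h * ?g h"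
    using r Dh gr a L by (intro mult_mono g_aux_mono) auto
  then have rg: "d * (r * ?g r) \<le> c * b" using h d by (simp add: field_simps)
  \<comment> \<open>Since \<open>h \<le> b / d\<close>, the radius is no larger than the quotient in
    the Cauchy length.\<close>
  have "h * 1 \<le> h * ?g h" using gh h by (intro mult_left_mono) auto
  also have "\<dots> \<le> 1 * (b / d)" unfolding h(2) using c b d by (intro mult_right_mono) auto
  finally have "D \<le> cauchy_length f x B D"
    using Dh B d by (intro cauchy_length_ge[of _ _ _ d]) (auto simp: b_def d_def)
  then have "\<kappa> * b * D \<le> \<kappa> * b * cauchy_length f x B D"
    using const b by (intro mult_left_mono) auto
  then have p: "\<kappa> * b * D \<le> p" using dec by (simp add: p_def b_def)
  moreover have "0 < \<kappa> * b * D" using const b D by simp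
  ultimately have p0: "0 < p" by linarith
  \<comment> \<open>The model error has two parts, each at most \<open>d * g r * r^2 / 2\<close>:
    the curvature term of the model, treated here with \<open>g r \<ge> 1\<close>, and the remainder
    of the descent inequality.\<close>
  have "\<bar>s \<bullet> (B *v s)\<bar> \<le> norm s * norm (B *v s)" by (rule Cauchy_Schwarz_ineq2)
  also have "\<dots> \<le> r * (matrix_norm B * r)"
    unfolding r_def matrix_norm_def by (intro mult_left_mono onorm) auto
  also have "\<dots> \<le> r * (d * r)" using B r by (intro mult_left_mono mult_right_mono) (auto simp: b_def d_def)
  also have "\<dots> \<le> r * (d * r) * ?g r" 
    using mult_left_mono[OF gr, of "r * (d * r)"] d r by simp
  finally have sBs: "- (s \<bullet> (B *v s)) \<le> d * ?g r * r\<^sup>2" by (simp add: power2_eq_square algebra_simps)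
  have "f (x + s) \<le> f x + grad f x \<bullet> s + d * ?g r * r\<^sup>2 / 2"
    using descent_inequality[OF C1 sm a L(2), of x s] d by (simp add: d_def b_def r_def)
  then have "f (x + s) - tr_model f x B s \<le> d * ?g r * r\<^sup>2"
    using sBs by (simp add: tr_model_def)
  also have "\<dots> = d * (r * ?g r) * r" by (simp add: power2_eq_square)
  also have "\<dots> \<le> c * b * D" 
    using rg r mult_pos_pos[OF c(1) b] by (intro mult_mono[OF rg]) auto
  also have "\<dots> = (1 - \<eta>) * (\<kappa> * b * D)" by (simp add: c_def)
  also have "\<dots> \<le> (1 - \<eta>) * p" using p const by (intro mult_left_mono) auto
  finally have "f (x + s) - tr_model f x B s \<le> (1 - \<eta>) * p" .
  moreover have "tr_model f x B 0 = f x" by (simp add: tr_model_def)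
  ultimately have "\<eta> * p \<le> f x - f (x + s)" by (simp add: p_def left_diff_distrib)
  then show ?thesis using p0 by (simp add: tr_ratio_def p_def field_simps)
qed

section \<open>Optimality gaps and counting by a potential\<close>

lemma convex_gap_le_grad:
  fixes f :: "'a::euclidean_space \<Rightarrow> real"
  assumes "convex_on UNIV f" "f differentiable (at x)" "norm (x - y) \<le> R"
  shows "f x - f y \<le> norm (grad f x) * R"
proof -
  have "f x - f y \<le> grad f x \<bullet> (x - y)"
    using convex_grad_ineq[OF assms(1,2), of y] by (simp add: inner_diff_right)
  also have "\<dots> \<le> norm (grad f x) * norm (x - y)" by (rule norm_cauchy_schwarz)
  also have "\<dots> \<le> norm (grad f x) * R" using assms by (intro mult_left_mono) auto
  finally show ?thesis .
qed

text \<open>Each counted step raises the potential \<open>W (\<delta> k)\<close> by at least 1: by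
  the mean value theorem the rise is the gap decrease times \<open>w z\<close> for some
  \<open>z\<close> below \<open>\<delta> k\<close>, and \<open>w\<close> is decreasing. The other
  steps do not lower it.\<close>

lemma card_le_potential_difference:
  fixes \<delta> :: "nat \<Rightarrow> real" and W w :: "real \<Rightarrow> real"
  assumes dec: "\<And>k. k < K \<Longrightarrow> \<delta> (Suc k) \<le> \<delta> k"
    and pos: "\<And>k. k \<le> K \<Longrightarrow> 0 < \<delta> k"
    and S: "\<And>k. k < K \<Longrightarrow> k \<in> S \<Longrightarrow> 1 \<le> (\<delta> k - \<delta> (Suc k)) * w (\<delta> k)"
    and W: "\<And>t. 0 < t \<Longrightarrow> (W has_real_derivative - w t) (at t)"
    and w0: "\<And>t. 0 < t \<Longrightarrow> 0 \<le> w t"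
    and anti: "\<And>u v. 0 < u \<Longrightarrow> u \<le> v \<Longrightarrow> w v \<le> w u"
  shows "real (card {k \<in> S. k < K}) \<le> W (\<delta> K) - W (\<delta> 0)"
  using dec pos S
proof (induction K)
  case (Suc K)
  have IH: "real (card {k \<in> S. k < K}) \<le> W (\<delta> K) - W (\<delta> 0)"
    using Suc by auto
  have le: "\<delta> (Suc K) \<le> \<delta> K" and ps: "0 < \<delta> (Suc K)" using Suc.prems by auto
  have MV: "(\<delta> K - \<delta> (Suc K)) * w (\<delta> K) \<le> W (\<delta> (Suc K)) - W (\<delta> K)"
  proof (cases "\<delta> (Suc K) = \<delta> K")
    case False
    then have "\<delta> (Suc K) < \<delta> K" using le by simp
    then obtain z where z: "\<delta> (Suc K) < z" "z < \<delta> K"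
      "W (\<delta> K) - W (\<delta> (Suc K)) = (\<delta> K - \<delta> (Suc K)) * - w z"
      using MVT2[of "\<delta> (Suc K)" "\<delta> K" W "\<lambda>t. - w t"] W ps by force
    have "(\<delta> K - \<delta> (Suc K)) * w (\<delta> K) \<le> (\<delta> K - \<delta> (Suc K)) * w z"
      using anti[of z "\<delta> K"] z ps le by (intro mult_left_mono) auto
    then show ?thesis using z(3) by (simp only: mult_minus_right)
  qed simp
  show ?case
  proof (cases "K \<in> S")
    case True
    then have "{k \<in> S. k < Suc K} = insert K {k \<in> S. k < K}" by auto
    then have "card {k \<in> S. k < Suc K} = Suc (card {k \<in> S. k < K})" by simp
    then show ?thesis using IH MV Suc.prems(3)[of K] True by simp
  next
    case False
    then have "{k \<in> S. k < Suc K} = {k \<in> S. k < K}" using less_Suc_eq by auto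
    moreover have "0 \<le> (\<delta> K - \<delta> (Suc K)) * w (\<delta> K)" using le w0 ps by (intro mult_nonneg_nonneg) auto
    ultimately show ?thesis using IH MV by simp
  qed
qed simp

lemma card_le_power_potential:
  fixes \<delta> :: "nat \<Rightarrow> real"
  assumes a: "\<alpha> \<le> 1" and PQ: "0 \<le> P" "0 \<le> Q" and eps: "0 < \<epsilon>"
    and dec: "\<And>k. k < K \<Longrightarrow> \<delta> (Suc k) \<le> \<delta> k"
    and gt: "\<And>k. k \<le> K \<Longrightarrow> \<epsilon> < \<delta> k"
    and S: "\<And>k. k < K \<Longrightarrow> k \<in> S \<Longrightarrow>
      1 \<le> (\<delta> k - \<delta> (Suc k)) * (P * \<delta> k powr (-2) + Q * \<delta> k powr (\<alpha> - 2))"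
  shows "real (card {k \<in> S. k < K}) \<le> P * \<epsilon> powr (-1)
    + (if \<alpha> = 1 then Q * ln (\<delta> 0 / \<epsilon>) else Q / (1 - \<alpha>) * (\<epsilon> powr (\<alpha> - 1) - \<delta> 0 powr (\<alpha> - 1)))"
proof -
  define w where "w = (\<lambda>t. P * t powr (-2) + Q * t powr (\<alpha> - 2))"
  define W where "W = (\<lambda>t. P * t powr (-1) + (if \<alpha> = 1 then - Q * ln t else Q / (1 - \<alpha>) * t powr (\<alpha> - 1)))"
  have dW: "(W has_real_derivative - w t) (at t)" if t: "0 < t" for t
  proof -
    have P: "((\<lambda>t. P * t powr (-1)) has_real_derivative P * (- 1 * t powr (- 1 - 1))) (at t)"
      using t by (intro DERIV_cmult has_real_derivative_powr)
    show ?thesis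
    proof (cases "\<alpha> = 1")
      case True
      have "((\<lambda>t. P * t powr (-1) + - Q * ln t) has_real_derivative
          P * (- 1 * t powr (- 1 - 1)) + - Q * (1 / t)) (at t)"
        using t by (intro DERIV_add DERIV_cmult DERIV_ln_divide P)
      then show ?thesis using True t by (simp add: W_def w_def powr_minus_divide)
    next
      case False
      have *: "Q / (1 - \<alpha>) * ((\<alpha> - 1) * y) = - Q * y" for y
        using False by (simp add: field_simps)
      have "((\<lambda>t. P * t powr (-1) + Q / (1 - \<alpha>) * t powr (\<alpha> - 1)) has_real_derivative
          P * (- 1 * t powr (- 1 - 1)) + Q / (1 - \<alpha>) * ((\<alpha> - 1) * t powr (\<alpha> - 1 - 1))) (at t)"
        using t by (intro DERIV_add DERIV_cmult has_real_derivative_powr P)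
      then show ?thesis using False unfolding * by (simp add: W_def w_def algebra_simps)
    qed
  qed
  have w0: "0 \<le> w t" for t using PQ by (simp add: w_def)
  have anti: "w v \<le> w u" if "0 < u" "u \<le> v" for u v
    unfolding w_def using that a PQ by (intro add_mono mult_left_mono powr_mono2') auto
  have pos: "0 < \<delta> k" if "k \<le> K" for k using gt[OF that] eps by simp
  have "real (card {k \<in> S. k < K}) \<le> W (\<delta> K) - W (\<delta> 0)"
    by (rule card_le_potential_difference[where w = w])
       (use dec S pos dW w0 anti in \<open>auto simp: w_def\<close>)
  also have "W (\<delta> K) \<le> W \<epsilon>"
  proof (rule DERIV_nonpos_imp_nonincreasing[where f = W])
    show "\<exists>y. (W has_real_derivative y) (at t) \<and> y \<le> 0" if "\<epsilon> \<le> t" for t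
      using dW[of t] w0[of t] eps that by (intro exI[of _ "- w t"]) auto
  qed (use gt[of K] in auto)
  finally have "real (card {k \<in> S. k < K}) \<le> W \<epsilon> - W (\<delta> 0)" by simp
  \<comment> \<open>This contribution of \<open>W (\<delta> 0)\<close> is dropped from the final
    bound.\<close>
  moreover have "0 \<le> P / \<delta> 0" using PQ pos[of 0] by simp
  ultimately show ?thesis using eps pos[of 0]
    by (cases "\<alpha> = 1") (simp_all add: W_def ln_div right_diff_distrib)
qed

section \<open>The iteration bound for convex functions\<close>

theorem theorem4p9:
  fixes f :: "real^'n \<Rightarrow> real"
    and x s :: "nat \<Rightarrow> real^'n" and B :: "nat \<Rightarrow> real^'n^'n" and \<Delta> :: "nat \<Rightarrow> real"
    and xstar :: "real^'n" and \<delta> :: "nat \<Rightarrow> real"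
    and \<alpha> L\<^sub>0 L\<^sub>1 b\<^sub>0 b\<^sub>1 \<kappa>\<^sub>m \<eta>\<^sub>1 \<eta>\<^sub>2 \<gamma>\<^sub>1 \<gamma>\<^sub>2 \<gamma>\<^sub>3 R \<epsilon> f_low \<theta> \<kappa>0 \<kappa>\<alpha> \<kappa>1 \<kappa>2 :: real
  assumes C1: "continuously_differentiable f"
    and bdd: "bdd_below (range f)"
    and f_low: "f_low = (INF y. f y)"
    and alpha: "0 \<le> \<alpha>" "\<alpha> \<le> 1"
    and L: "0 \<le> L\<^sub>0" "0 \<le> L\<^sub>1" "L\<^sub>0 > 0 \<or> L\<^sub>1 > 0"
    and smooth: "gen_smooth \<alpha> L\<^sub>0 L\<^sub>1 f"
    and constants: "0 < \<kappa>\<^sub>m" "\<kappa>\<^sub>m \<le> 1/2" "0 < \<eta>\<^sub>1" "\<eta>\<^sub>1 \<le> \<eta>\<^sub>2" "\<eta>\<^sub>2 < 1"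
      "0 < \<gamma>\<^sub>1" "\<gamma>\<^sub>1 \<le> \<gamma>\<^sub>2" "\<gamma>\<^sub>2 < 1" "1 \<le> \<gamma>\<^sub>3"
    and run: "trust_region_run f \<kappa>\<^sub>m \<eta>\<^sub>1 \<eta>\<^sub>2 \<gamma>\<^sub>1 \<gamma>\<^sub>2 \<gamma>\<^sub>3 x \<Delta> B s"
    and b: "0 \<le> b\<^sub>0" "0 \<le> b\<^sub>1" "b\<^sub>0 \<le> L\<^sub>0" "b\<^sub>1 \<le> L\<^sub>1"
    and B_bound: "\<forall>k. matrix_norm (B k) \<le> b\<^sub>0 + b\<^sub>1 * rpow (norm (grad f (x k))) \<alpha>"
    and convex: "convex_on UNIV f"
    and minimizer: "\<forall>y. f xstar \<le> f y"
    and R: "0 < R" "\<forall>y. f y \<le> f (x 0) \<longrightarrow> norm (y - xstar) \<le> R"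
    and inf_succ: "infinite (successful_iterations f \<eta>\<^sub>1 x B s)"
    and delta: "\<forall>k. \<delta> k = f (x k) - f_low"
    and eps: "0 < \<epsilon>" "\<epsilon> < 1"
    and theta: "\<theta> = theta_min \<alpha> L\<^sub>0 L\<^sub>1 \<kappa>\<^sub>m \<eta>\<^sub>2 \<gamma>\<^sub>1 (norm (grad f (x 0))) (\<Delta> 0)"
    and k0: "\<kappa>0 = R\<^sup>2 / (\<eta>\<^sub>1 * \<kappa>\<^sub>m\<^sup>2 * (1 - \<eta>\<^sub>2) * \<theta>)"
    and ka: "\<alpha> < 1 \<Longrightarrow>
      \<kappa>\<alpha> = L\<^sub>1 * (1 + (\<kappa>\<^sub>m * (1 - \<eta>\<^sub>2)) powr \<alpha>) / (R powr \<alpha> * (1 - \<alpha>)) * \<kappa>0"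
    and k1: "\<kappa>1 = L\<^sub>1 * (1 + \<kappa>\<^sub>m * (1 - \<eta>\<^sub>2)) / R * \<kappa>0"
    and k2: "\<kappa>2 = L\<^sub>0 * \<kappa>0"
  shows "(\<epsilon> < \<delta> 0 \<longrightarrow> (\<exists>k. first_crossing \<delta> \<epsilon> k)) \<and>
    (\<forall>khat. first_crossing \<delta> \<epsilon> khat \<longrightarrow>
      (\<alpha> < 1 \<longrightarrow>
        real (card {k \<in> successful_iterations f \<eta>\<^sub>1 x B s. k < khat})
          \<le> \<kappa>\<alpha> * \<epsilon> powr (\<alpha> - 1) + \<kappa>2 * \<epsilon> powr (-1) - \<kappa>\<alpha> * \<delta> 0 powr (\<alpha> - 1)) \<and>
      (\<alpha> = 1 \<longrightarrow>
        real (card {k \<in> successful_iterations f \<eta>\<^sub>1 x B s. k < khat})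
          \<le> \<kappa>1 * ln (\<delta> 0 / \<epsilon>) + \<kappa>2 * \<epsilon> powr (-1)))"
proof -
  define S where "S = successful_iterations f \<eta>\<^sub>1 x B s"
  define c where "c = \<kappa>\<^sub>m * (1 - \<eta>\<^sub>2)"
  define G where "G = (\<lambda>k. norm (grad f (x k)))"
  define h where "h = (\<lambda>k. h_aux \<alpha> L\<^sub>0 L\<^sub>1 (G k) (c * psi_aux \<alpha> L\<^sub>0 L\<^sub>1 (G k)))"
  \<comment> \<open>\<open>M\<close> is the denominator in the lower bound for \<open>h_aux\<close>.
    Below, \<open>Q\<close> is chosen so that
    \<open>\<kappa>2 * t powr (-2) + Q * t powr (\<alpha> - 2)\<close> equals
    \<open>\<kappa>0 * M (t / R) / t^2\<close>.\<close>
  define M where "M = (\<lambda>u. L\<^sub>0 + L\<^sub>1 * (1 + c powr \<alpha>) * rpow u \<alpha>)"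
  define \<rho> where "\<rho> = (\<lambda>k. tr_ratio f (x k) (B k) (s k))"
  define Q where "Q = L\<^sub>1 * (1 + c powr \<alpha>) / R powr \<alpha> * \<kappa>0"
  have c: "0 < c" "c \<le> 1"
    using constants mult_le_one[of \<kappa>\<^sub>m "1 - \<eta>\<^sub>2"] by (auto simp: c_def)
  have diff: "f differentiable (at y)" for y
    using C1 by (simp add: continuously_differentiable_def)
  have step: "x (Suc k) = (if \<eta>\<^sub>1 \<le> \<rho> k then x k + s k else x k)"
    "\<eta>\<^sub>2 \<le> \<rho> k \<Longrightarrow> \<Delta> k \<le> \<Delta> (Suc k)"
    "\<eta>\<^sub>1 \<le> \<rho> k \<Longrightarrow> \<rho> k < \<eta>\<^sub>2 \<Longrightarrow> \<gamma>\<^sub>2 * \<Delta> k \<le> \<Delta> (Suc k)"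
    "\<rho> k < \<eta>\<^sub>1 \<Longrightarrow> \<gamma>\<^sub>1 * \<Delta> k \<le> \<Delta> (Suc k)"
    and size: "norm (s k) \<le> \<Delta> k"
    and model: "\<kappa>\<^sub>m * G k * cauchy_length f (x k) (B k) (\<Delta> k)
      \<le> tr_model f (x k) (B k) 0 - tr_model f (x k) (B k) (s k)"
    and Delta0: "0 < \<Delta> 0" for k
    using run unfolding trust_region_run_def Let_def \<rho>_def G_def by auto
  have shrink: "\<gamma>\<^sub>1 * \<Delta> k \<le> \<Delta> (Suc k)" if "0 \<le> \<Delta> k" for k
  proof -
    have "\<gamma>\<^sub>1 * \<Delta> k \<le> \<gamma>\<^sub>2 * \<Delta> k" "\<gamma>\<^sub>1 * \<Delta> k \<le> 1 * \<Delta> k"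
      using that constants by (intro mult_right_mono; simp)+
    then show ?thesis using step(2-4)[of k] by linarith
  qed
  have Delta: "0 < \<Delta> k" for k
  proof (induction k)
    case (Suc k)
    then show ?case using shrink[of k] mult_pos_pos[of \<gamma>\<^sub>1 "\<Delta> k"] constants by linarith
  qed (rule Delta0)
  have Bk: "matrix_norm (B k) \<le> L\<^sub>0 + L\<^sub>1 * rpow (G k) \<alpha>" for k
    using B_bound[rule_format, of k] b mult_right_mono[OF b(4), of "rpow (G k) \<alpha>"]
    by (simp add: G_def)
  have "f_low = f xstar"
    unfolding f_low using minimizer bdd by (intro antisym cINF_lower cINF_greatest) auto
  then have dk: "\<delta> k = f (x k) - f xstar" for k using delta by simp
  have d_nonneg: "0 \<le> \<delta> k" for k using minimizer by (simp add: dk)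
  have decrease: "\<eta>\<^sub>1 * q \<le> \<delta> k - \<delta> (Suc k)"
    if "\<eta>\<^sub>1 \<le> \<rho> k" "0 \<le> q" "q \<le> \<kappa>\<^sub>m * G k * cauchy_length f (x k) (B k) (\<Delta> k)" for k q
    using tr_ratio_decrease[of \<eta>\<^sub>1 f "x k" "B k" "s k" q] that model[of k] step(1)[of k] constants
    by (simp add: \<rho>_def dk)
  have "0 \<le> cauchy_length f (x k) (B k) (\<Delta> k)" for k
    using Delta[of k] matrix_norm_nonneg[of "B k"] by (simp add: cauchy_length_def)
  then have "0 \<le> \<kappa>\<^sub>m * G k * cauchy_length f (x k) (B k) (\<Delta> k)" for k
    using constants by (simp add: G_def)
  then have d_Suc: "\<delta> (Suc k) \<le> \<delta> k" for k
    using decrease[of k 0] step(1)[of k] by (cases "\<eta>\<^sub>1 \<le> \<rho> k") (auto simp: dk)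
  have d_mono: "\<delta> k \<le> \<delta> j" if "j \<le> k" for j k
    using lift_Suc_antimono_le[of \<delta>, OF d_Suc that] .
  have gap: "\<delta> k / R \<le> G k" for k
  proof -
    \<comment> \<open>Monotonicity keeps all iterates in the initial sublevel set, where
      \<open>R\<close> applies.\<close>
    have "norm (x k - xstar) \<le> R" using R d_mono[of 0 k] by (simp add: dk)
    then show ?thesis
      using convex_gap_le_grad[OF convex diff, of "x k" xstar R] R by (simp add: dk G_def field_simps)
  qed
  have Gpos: "0 < G k" if "0 < \<delta> k" for k
    using gap[of k] divide_pos_pos[OF that R(1)] by linarith
  have psi_pos: "0 < c * psi_aux \<alpha> L\<^sub>0 L\<^sub>1 (G k)" if "0 < \<delta> k" for k
    using c linear_rpow_pos[OF L Gpos[OF that]] Gpos[OF that] by (simp add: psi_aux_def)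
  have hpos: "0 < h k" if "0 < \<delta> k" for k
    unfolding h_def by (rule h_aux_props(1)[OF alpha L(2) psi_pos[OF that]])
  have theta': "\<theta> = \<gamma>\<^sub>1 * min 1 (\<Delta> 0 / h 0)"
    by (simp add: theta theta_min_def h_def c_def G_def)
  have theta_pos: "0 < \<theta>" if "0 < \<delta> 0"
    using hpos[OF that] Delta0 constants by (simp add: theta')
  have "\<theta> \<le> \<gamma>\<^sub>1 * 1" unfolding theta' using constants by (intro mult_left_mono) auto
  then have theta_le: "\<theta> \<le> \<gamma>\<^sub>1" "\<theta> \<le> 1" using constants by auto
  \<comment> \<open>Induction with \<open>q\<close> fixed. The start is the second entry of the
    minimum in \<open>\<theta>\<close>. Later the radius does not shrink unless
    \<open>h k \<le> \<Delta> k\<close>; then \<open>q \<le> \<Delta> k\<close>, and a reduction by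
    at most \<open>\<gamma>\<^sub>1 \<ge> \<theta>\<close> is harmless.\<close>
  have radius: "\<theta> * q \<le> \<Delta> k" if "0 < \<delta> k" "0 < q" "\<And>j. j \<le> k \<Longrightarrow> q \<le> h j" for k q
    using that(1,3)
  proof (induction k)
    case 0
    have "\<theta> * q \<le> (\<gamma>\<^sub>1 * (\<Delta> 0 / h 0)) * h 0"
      unfolding theta' using 0 that(2) hpos[of 0] Delta0 constants
      by (intro mult_mono mult_left_mono) auto
    also have "\<dots> = \<gamma>\<^sub>1 * \<Delta> 0" using hpos[of 0] 0 by simp
    also have "\<dots> \<le> \<Delta> 0" using Delta0 constants by (intro mult_left_le_one_le) auto
    finally show ?case .
  next
    case (Suc k)
    have dp: "0 < \<delta> k" using Suc.prems(1) d_Suc[of k] by linarith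
    have IH: "\<theta> * q \<le> \<Delta> k" using Suc dp by auto
    show ?case
    proof (cases "\<eta>\<^sub>2 \<le> \<rho> k")
      case True
      then show ?thesis using IH step(2)[of k] by linarith
    next
      case False
      have "h k \<le> \<Delta> k"
      proof (rule ccontr)
        assume "\<not> h k \<le> \<Delta> k"
        then have "\<eta>\<^sub>2 \<le> \<rho> k" unfolding \<rho>_def
          by (intro very_successful_if_small_radius[OF C1 smooth alpha L(1,2), of \<kappa>\<^sub>m \<eta>\<^sub>2 _ _ "\<Delta> k"])
             (use constants Gpos[OF dp] Bk[of k] Delta[of k] size[of k] model[of k]
               in \<open>auto simp: G_def h_def c_def\<close>)
        then show False using False by simp
      qed
      then have "q \<le> \<Delta> k" using Suc.prems(2)[of k] by simp
      then have "\<theta> * q \<le> \<gamma>\<^sub>1 * \<Delta> k"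
        using theta_le that(2) constants by (intro mult_mono) auto
      then show ?thesis using shrink[of k] Delta[of k] by simp
    qed
  qed
  have c1: "0 < 1 + c powr \<alpha>" by (intro add_pos_nonneg) auto
  have Mpos: "0 < M u" if "0 < u" for u
    unfolding M_def using L that c1 by (intro linear_rpow_pos) auto
  have prog: "1 \<le> (\<delta> k - \<delta> (Suc k)) * (\<kappa>2 * \<delta> k powr (-2) + Q * \<delta> k powr (\<alpha> - 2))"
    if k: "k \<in> S" and dp: "0 < \<delta> k" for k
  proof -
    \<comment> \<open>\<open>u\<close> is below every \<open>G j\<close> with
      \<open>j \<le> k\<close>, because gaps decrease; \<open>q\<close> is therefore a common lower
      bound of all \<open>h j\<close> up to \<open>k\<close>, as \<open>radius\<close>
      requires.\<close>
    define u where "u = \<delta> k / R"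
    define q where "q = c * (u / M u)"
    have u: "0 < u" using dp R by (simp add: u_def)
    have Mu: "0 < M u" using Mpos[OF u] .
    have q: "0 < q" using c u Mu by (simp add: q_def)
    have th: "0 < \<theta>" using theta_pos dp d_mono[of 0 k] by simp
    have q_le: "q \<le> c * (G j / M (G j))" if "j \<le> k" for j
      unfolding q_def M_def using c c1 L u
    proof (intro mult_left_mono quotient_rpow_mono alpha)
      show "u \<le> G j"
        using gap[of j] divide_right_mono[OF d_mono[OF that], of R] R by (simp add: u_def)
    qed auto
    have "q \<le> h j" if "j \<le> k" for j
    proof -
      have "0 < G j" using Gpos d_mono[OF that] dp by simp
      then show ?thesis
        using q_le[OF that] h_aux_lower_bound[OF alpha L, of "G j" c] c
        by (simp add: h_def M_def)
    qed
    then have rad: "\<theta> * q \<le> \<Delta> k" using radius[OF dp q] by blast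
    have Gk: "0 < G k" using Gpos[OF dp] .
    have Dk: "0 < L\<^sub>0 + L\<^sub>1 * rpow (G k) \<alpha>"
      by (rule linear_rpow_pos[OF L Gk])
    \<comment> \<open>\<open>rad\<close> handles the radius in the Cauchy length; this chain handles
      the quotient of gradient norm and matrix norm.\<close>
    have "\<theta> * q \<le> q" using theta_le q th by (intro mult_left_le_one_le) auto
    also have "q \<le> (c * G k) / M (G k)" using q_le[of k] by simp
    also have "\<dots> \<le> G k / (L\<^sub>0 + L\<^sub>1 * rpow (G k) \<alpha>)"
    proof (rule frac_le)
      show "c * G k \<le> G k" using c Gk by (intro mult_left_le_one_le) auto
      have "L\<^sub>1 * 1 * rpow (G k) \<alpha> \<le> L\<^sub>1 * (1 + c powr \<alpha>) * rpow (G k) \<alpha>"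
        using L by (intro mult_right_mono mult_left_mono) auto
      then show "L\<^sub>0 + L\<^sub>1 * rpow (G k) \<alpha> \<le> M (G k)" by (simp add: M_def)
    qed (use Gk Dk in auto)
    finally have cl: "\<theta> * q \<le> cauchy_length f (x k) (B k) (\<Delta> k)"
      using rad Bk[of k] Dk by (intro cauchy_length_ge[of _ _ _ "L\<^sub>0 + L\<^sub>1 * rpow (G k) \<alpha>"])
        (auto simp: G_def)
    have "u \<le> G k" using gap[of k] by (simp add: u_def)
    then have "\<kappa>\<^sub>m * u * (\<theta> * q) \<le> \<kappa>\<^sub>m * G k * cauchy_length f (x k) (B k) (\<Delta> k)"
      using cl u Gk th q constants by (intro mult_mono) auto
    then have dec: "\<eta>\<^sub>1 * (\<kappa>\<^sub>m * u * (\<theta> * q)) \<le> \<delta> k - \<delta> (Suc k)"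
      using k u th q constants
      by (intro decrease) (auto simp: S_def successful_iterations_def \<rho>_def)
    \<comment> \<open>One factor \<open>\<kappa>\<^sub>m\<close> stems from the Cauchy decrease, the
      other sits in \<open>c\<close>. With \<open>u = \<delta> k / R\<close> this makes the product
      of guaranteed decrease and weight exactly 1.\<close>
    have k0': "\<kappa>0 = R\<^sup>2 / (\<eta>\<^sub>1 * \<kappa>\<^sub>m * c * \<theta>)"
      by (simp add: k0 c_def power2_eq_square mult_ac)
    have w: "\<kappa>2 * \<delta> k powr (-2) + Q * \<delta> k powr (\<alpha> - 2) = \<kappa>0 * M u / (\<delta> k)\<^sup>2"
      using dp R
      by (simp add: k2 Q_def M_def rpow_eq_powr u_def powr_divide powr_diff powr_minus field_simps)
    have "1 = (\<eta>\<^sub>1 * (\<kappa>\<^sub>m * u * (\<theta> * q))) * (\<kappa>0 * M u / (\<delta> k)\<^sup>2)"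
      using dp R Mu th c constants unfolding k0' q_def
      by (simp add: u_def power2_eq_square field_simps)
    also have "\<dots> \<le> (\<delta> k - \<delta> (Suc k)) * (\<kappa>0 * M u / (\<delta> k)\<^sup>2)"
      using dec Mu th c constants by (intro mult_right_mono) (auto simp: k0')
    finally show ?thesis unfolding w .
  qed
  define bound where "bound = \<kappa>2 * \<epsilon> powr (-1) + (if \<alpha> = 1 then Q * ln (\<delta> 0 / \<epsilon>)
    else Q / (1 - \<alpha>) * (\<epsilon> powr (\<alpha> - 1) - \<delta> 0 powr (\<alpha> - 1)))"
  have bound: "real (card {k \<in> S. k < K}) \<le> bound" if K: "\<epsilon> < \<delta> K" for K
  proof -
    have gt: "\<epsilon> < \<delta> k" if "k \<le> K" for k using d_mono[OF that] K by simp
    have "0 \<le> \<kappa>0" using theta_pos gt[of 0] eps constants by (simp add: k0)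
    then have "0 \<le> \<kappa>2" "0 \<le> Q" using L by (auto simp: k2 Q_def)
    then show ?thesis unfolding bound_def
    proof (rule card_le_power_potential[OF alpha(2) _ _ eps(1), where \<delta> = \<delta>])
      show "1 \<le> (\<delta> k - \<delta> (Suc k)) * (\<kappa>2 * \<delta> k powr (-2) + Q * \<delta> k powr (\<alpha> - 2))"
        if "k < K" "k \<in> S" for k
        using prog[OF that(2)] gt[of k] that(1) eps by simp
    qed (simp_all add: d_Suc gt)
  qed
  have "\<exists>k. first_crossing \<delta> \<epsilon> k" if start: "\<epsilon> < \<delta> 0"
  proof -
    \<comment> \<open>Without a crossing the gap would stay above \<open>\<epsilon>\<close> forever,
      and \<open>bound\<close> would cap the successes before every \<open>K\<close>, although there
      are infinitely many.\<close>
    have "\<exists>k. \<epsilon> < \<delta> k \<and> \<delta> (Suc k) \<le> \<epsilon>"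
    proof (rule ccontr)
      assume "\<not> ?thesis"
      then have "\<epsilon> < \<delta> k \<Longrightarrow> \<epsilon> < \<delta> (Suc k)" for k by (meson not_le)
      then have gt: "\<epsilon> < \<delta> k" for k using start by (induction k) auto
      obtain n :: nat where n: "bound < real n" using reals_Archimedean2 by blast
      obtain T where T: "finite T" "card T = n" "T \<subseteq> S"
        using infinite_arbitrarily_large[OF inf_succ] unfolding S_def by blast
      obtain K where K: "\<And>k. k \<in> T \<Longrightarrow> k < K" using T(1) finite_nat_set_iff_bounded by auto
      have "card T \<le> card {k \<in> S. k < K}" using T K by (intro card_mono) auto
      then show False using bound[OF gt, of K] n T by simp
    qed
    then show ?thesis
      unfolding first_crossing_def by (subst (asm) exists_least_iff)
  qed
  moreover have "bound = \<kappa>\<alpha> * \<epsilon> powr (\<alpha> - 1) + \<kappa>2 * \<epsilon> powr (-1) - \<kappa>\<alpha> * \<delta> 0 powr (\<alpha> - 1)"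
    if "\<alpha> < 1"
  proof -
    have "\<kappa>\<alpha> = Q / (1 - \<alpha>)" using ka[OF that] by (simp add: Q_def c_def)
    then show ?thesis using that by (simp add: bound_def right_diff_distrib)
  qed
  moreover have "bound = \<kappa>1 * ln (\<delta> 0 / \<epsilon>) + \<kappa>2 * \<epsilon> powr (-1)" if "\<alpha> = 1"
    using that c R by (simp add: bound_def Q_def k1 c_def)
  \<comment> \<open>The gap at \<open>khat\<close> still exceeds \<open>\<epsilon>\<close>, so
    \<open>bound\<close> applies with \<open>K = khat\<close>.\<close>
  moreover have "real (card {k \<in> S. k < khat}) \<le> bound" if "first_crossing \<delta> \<epsilon> khat" for khat
    using that by (intro bound) (simp add: first_crossing_def)
  ultimately show ?thesis unfolding S_def by auto
qed

end
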